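(* Let $1\le k<n$, let $\Delta\subset\mathbb{C}$ be the unit disc, and let $u$ be a plurisubharmonic function on $\Delta^n$ with $u\leq 0$. Write $z=(z',z'')$ with $z'\in\Delta^k$, $z''\in\Delta^{n-k}$. Then the function $\phi_u$ on $\Delta^k$ is constant.
   Context: For $u$ plurisubharmonic and $\leq 0$ on $\Delta^n$, define $\phi_u(z')=\left(-\nu_u(z',\cdot)(0)\right)^*$ for $z'\in\Delta^k$, where $\nu_u(z',\cdot)(0)$ is the Lelong number at $0\in\Delta^{n-k}$ of the function $z''\mapsto u(z',z'')$, and ${}^*$ denotes the upper semicontinuous regularization on $\Delta^k$. *)

theory Defs
  imports "HOL-Analysis.Analysis"
begin

text \<open>Points of C^n = C^k x C^(n-k) are pairs (z', z'') with z' :: complex^'k, z'' :: complex^'m,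
  where CARD('k) = k and CARD('m) = n - k (both at least 1).\<close>

definition polydisc :: "(complex ^ 'k) set" where
  "polydisc = {z. \<forall>i. cmod (z $ i) < 1}"

definition usc_on :: "'a::topological_space set \<Rightarrow> ('a \<Rightarrow> ereal) \<Rightarrow> bool" where
  "usc_on S u \<longleftrightarrow> (\<forall>x\<in>S. \<forall>c. u x < c \<longrightarrow> eventually (\<lambda>y. u y < c) (at x within S))"

definition circle_mean :: "(real \<Rightarrow> ereal) \<Rightarrow> ereal" where
  "circle_mean f =
     (enn2ereal (\<integral>\<^sup>+ t. e2ennreal (f t) * indicator {0..2*pi} t \<partial>lborel)
      - enn2ereal (\<integral>\<^sup>+ t. e2ennreal (- f t) * indicator {0..2*pi} t \<partial>lborel)) / ereal (2*pi)"

definition cline :: "complex ^ 'k \<Rightarrow> complex ^ 'm \<Rightarrow> complex ^ 'k \<Rightarrow> complex ^ 'm \<Rightarrow> complex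
    \<Rightarrow> (complex ^ 'k) \<times> (complex ^ 'm)" where
  "cline a b c d \<zeta> = ((\<chi> i. a $ i + \<zeta> * c $ i), (\<chi> i. b $ i + \<zeta> * d $ i))"

definition psh_on :: "((complex ^ 'k) \<times> (complex ^ 'm)) set \<Rightarrow> ((complex ^ 'k) \<times> (complex ^ 'm) \<Rightarrow> ereal) \<Rightarrow> bool" where
  "psh_on \<Omega> u \<longleftrightarrow> open \<Omega> \<and> usc_on \<Omega> u \<and> (\<exists>z\<in>\<Omega>. u z \<noteq> -\<infinity>) \<and>
     (\<forall>a b c d. (\<forall>\<zeta>. cmod \<zeta> \<le> 1 \<longrightarrow> cline a b c d \<zeta> \<in> \<Omega>) \<longrightarrow>
        u (cline a b c d 0) \<le> circle_mean (\<lambda>t. u (cline a b c d (cis t))))"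

definition lelong0 :: "(complex ^ 'm \<Rightarrow> ereal) \<Rightarrow> ereal" where
  "lelong0 v = Lim (at_right 0) (\<lambda>r. (SUP w\<in>ball 0 r. v w) / ereal (ln r))"

definition usc_reg :: "'a::metric_space set \<Rightarrow> ('a \<Rightarrow> ereal) \<Rightarrow> 'a \<Rightarrow> ereal" where
  "usc_reg S f z = (INF r\<in>{0<..}. SUP w\<in>ball z r \<inter> S. f w)"

definition phi :: "((complex ^ 'k) \<times> (complex ^ 'm) \<Rightarrow> ereal) \<Rightarrow> complex ^ 'k \<Rightarrow> ereal" where
  "phi u = usc_reg polydisc (\<lambda>z'. - lelong0 (\<lambda>z''. u (z', z'')))"

end

theory Submission
  imports Defs "HOL-Complex_Analysis.Cauchy_Integral_Formula"
begin

text \<open>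
  Let \<open>\<nu>(z')\<close> be the Lelong number at 0 of \<open>u(z', \<cdot>)\<close>. By the three circles theorem, \<open>\<nu>(z') \<ge> l\<close> holds iff
  \<open>u(z', y) \<le> l ln r\<close> whenever \<open>|y| < r < 1\<close>. Suppose \<open>\<nu> \<ge> l\<close> near \<open>b = a + c\<close>. If \<open>h\<close> is holomorphic with
  positive real part and \<open>h 0 = 1\<close>, then along the curve \<open>\<zeta> \<mapsto> (a + \<zeta> c, e r\<^bsup>h \<zeta>\<^esup>)\<close>, \<open>|e| < 1\<close>, the function \<open>u\<close>
  is bounded by \<open>l Re (h \<zeta>) ln r\<close> for \<open>\<zeta>\<close> near 1, and by 0 elsewhere. Letting \<open>Re h\<close> run through Poisson
  kernels concentrating at 1, the maximum principle gives \<open>u(a, e r) \<le> l ln r\<close>, so \<open>\<nu>(a) \<ge> l\<close>. Hence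
  \<open>-\<nu>(a) \<le> \<phi>(b)\<close> for all \<open>a\<close>, \<open>b\<close> close to each other, and \<open>\<phi>\<close> is locally constant.

  Plurisubharmonicity is only assumed along affine discs. The maximum principle along a
  holomorphic graph \<open>w = g \<zeta>\<close> is obtained from it by penalisation: maximise
  \<open>u - q + \<epsilon> |\<zeta>|\<^sup>2 - n |w - g \<zeta>|\<^sup>2\<close> and let \<open>n\<close> tend to infinity.
\<close>

section \<open>Upper semicontinuous functions\<close>

lemma usc_onD:
  fixes v :: "'a::metric_space \<Rightarrow> ereal"
  assumes "usc_on S v" "x \<in> S" "v x < c"
  obtains d where "d > 0" "\<And>y. y \<in> S \<Longrightarrow> dist y x < d \<Longrightarrow> v y < c"
proof -
  have "eventually (\<lambda>y. v y < c) (at x within S)"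
    using assms by (auto simp: usc_on_def)
  then obtain d where "d > 0" "\<forall>y\<in>S. y \<noteq> x \<and> dist y x < d \<longrightarrow> v y < c"
    by (auto simp: eventually_at)
  with assms(3) that show thesis by metis
qed

lemma usc_on_subset: "usc_on S v \<Longrightarrow> T \<subseteq> S \<Longrightarrow> usc_on T v"
  unfolding usc_on_def by (meson at_le filter_leD subsetD)

lemma usc_on_compose:
  assumes u: "usc_on T u" and f: "continuous_on S f" "f ` S \<subseteq> T"
  shows "usc_on S (\<lambda>x. u (f x))"
  unfolding usc_on_def
proof (intro ballI allI impI)
  fix x c assume x: "x \<in> S" "u (f x) < c"
  then have "eventually (\<lambda>y. u y < c) (at (f x) within T)"
    using u f by (auto simp: usc_on_def)
  then have *: "eventually (\<lambda>y. y \<in> T \<longrightarrow> u y < c) (nhds (f x))"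
    using x(2) by (auto simp: eventually_at_filter elim!: eventually_mono)
  have "(f \<longlongrightarrow> f x) (at x within S)"
    using f(1) x(1) by (auto simp: continuous_on_def)
  then have "eventually (\<lambda>y. f y \<in> T \<longrightarrow> u (f y) < c) (at x within S)"
    using * by (auto simp: filterlim_iff)
  then show "eventually (\<lambda>y. u (f y) < c) (at x within S)"
    using f(2) by (auto simp: eventually_at_filter elim!: eventually_mono)
qed

lemma usc_on_add_continuous:
  assumes "usc_on S v" "continuous_on S k"
  shows "usc_on S (\<lambda>x. v x + ereal (k x))"
  unfolding usc_on_def
proof (intro ballI allI impI)
  fix x c assume x: "x \<in> S" "v x + ereal (k x) < c"
  then have "v x < c - ereal (k x)"
    by (cases "v x"; cases c) auto
  then obtain m where m: "v x < ereal m" "ereal m < c - ereal (k x)"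
    using ereal_dense2 by blast
  have 1: "eventually (\<lambda>y. v y < ereal m) (at x within S)"
    using assms(1) x(1) m(1) by (auto simp: usc_on_def)
  have "((\<lambda>y. ereal (m + k y)) \<longlongrightarrow> ereal (m + k x)) (at x within S)"
    using assms(2) x(1) by (auto simp: continuous_on_def intro!: tendsto_intros)
  moreover have "ereal (m + k x) < c"
    using m(2) by (cases c) auto
  ultimately have 2: "eventually (\<lambda>y. ereal (m + k y) < c) (at x within S)"
    by (rule order_tendstoD)
  show "eventually (\<lambda>y. v y + ereal (k y) < c) (at x within S)"
    using 1 2
  proof eventually_elim
    case (elim y)
    have "v y + ereal (k y) \<le> ereal m + ereal (k y)"
      using elim(1) by (intro add_right_mono) auto
    with elim(2) show ?case by auto
  qed
qed

text \<open>Without a maximum, each \<open>x\<close> has a competitor \<open>Y x\<close> of larger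
  value, and \<open>v < v (Y x)\<close> persists on a neighbourhood of \<open>x\<close>. For a
  finite subcover, the best of the finitely many competitors would itself be beaten by another
  one.\<close>

lemma usc_on_attains_sup:
  fixes v :: "'a::metric_space \<Rightarrow> ereal"
  assumes "compact K" "K \<noteq> {}" "usc_on K v"
  obtains x where "x \<in> K" "\<And>y. y \<in> K \<Longrightarrow> v y \<le> v x"
proof (rule ccontr)
  assume "\<not> thesis"
  then have "\<forall>x\<in>K. \<exists>y\<in>K. v x < v y"
    using that by (meson not_le)
  then obtain Y where Y: "\<And>x. x \<in> K \<Longrightarrow> Y x \<in> K \<and> v x < v (Y x)" by metis
  then have "\<forall>x\<in>K. \<exists>d>0. \<forall>y\<in>K. dist y x < d \<longrightarrow> v y < v (Y x)"
    using usc_onD[OF assms(3)] by metis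
  then obtain d where d: "\<And>x. x \<in> K \<Longrightarrow> d x > 0"
      "\<And>x y. x \<in> K \<Longrightarrow> y \<in> K \<Longrightarrow> dist y x < d x \<Longrightarrow> v y < v (Y x)"
    by metis
  have "K \<subseteq> (\<Union>x\<in>K. ball x (d x))" using d(1) by force
  then obtain C where C: "C \<subseteq> K" "finite C" "K \<subseteq> (\<Union>x\<in>C. ball x (d x))"
    using compactE_image[OF assms(1), of K "\<lambda>x. ball x (d x)"] by auto
  then have "C \<noteq> {}" using assms(2) by auto
  then have "Max ((v \<circ> Y) ` C) \<in> (v \<circ> Y) ` C"
    using C(2) by (intro Max_in) auto
  then obtain x0 where x0: "x0 \<in> C" "v (Y x0) = Max ((v \<circ> Y) ` C)" by auto
  have "Y x0 \<in> K" using x0 C(1) Y by auto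
  then obtain x1 where x1: "x1 \<in> C" "Y x0 \<in> ball x1 (d x1)" using C(3) by auto
  then have "v (Y x0) < v (Y x1)"
    using d(2)[of x1 "Y x0"] C(1) \<open>Y x0 \<in> K\<close> by (auto simp: dist_commute)
  moreover have "v (Y x1) \<le> v (Y x0)"
    unfolding x0(2) using C(2) x1(1) by (intro Max_ge) auto
  ultimately show False by simp
qed

section \<open>Circle means\<close>

lemma has_integral_circle_mean_value:
  fixes H :: "complex \<Rightarrow> complex"
  assumes "H holomorphic_on cball 0 1"
  shows "((\<lambda>t. H (cis t)) has_integral (2 * pi * H 0)) {0..2*pi}"
proof -
  have "((\<lambda>u. H u / (u - 0)) has_contour_integral (2 * of_real pi * \<i> * H 0)) (circlepath 0 1)"
    by (rule Cauchy_integral_circlepath_simple) (use assms in auto)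
  then have "((\<lambda>t. H (cis t) / cis t * \<i> * cis t) has_integral (2 * pi * \<i> * H 0)) {0..2*pi}"
    by (simp add: circlepath_def has_contour_integral_part_circlepath_iff)
  then have "((\<lambda>t. (1 / \<i>) * (\<i> * H (cis t))) has_integral ((1/\<i>) * (2 * pi * \<i> * H 0))) {0..2*pi}"
    by (intro has_integral_mult_right) (simp add: mult_ac)
  moreover have "(1/\<i>) * (2 * pi * \<i> * H 0) = 2 * pi * H 0" by (simp add: field_simps)
  moreover have "(\<lambda>t. (1 / \<i>) * (\<i> * H (cis t))) = (\<lambda>t. H (cis t))" by simp
  ultimately show ?thesis by (simp only:)
qed

text \<open>Positive and negative parts are compared separately, following the definition of
  \<open>circle_mean\<close>. Since \<open>I\<close> and \<open>J\<close> are finite, the bounding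
  difference is an ordinary real number even where \<open>f\<close> takes the value
  \<open>-\<infinity>\<close>.\<close>

lemma circle_mean_le:
  assumes le: "\<And>t. f t \<le> ereal (p t)" and cont: "continuous_on {0..2*pi} p"
    and int: "(p has_integral (2 * pi * c)) {0..2*pi}"
  shows "circle_mean f \<le> ereal c"
proof -
  define I J where "I = integral {0..2*pi} (\<lambda>t. max 0 (p t))"
    and "J = integral {0..2*pi} (\<lambda>t. max 0 (- p t))"
  have I: "((\<lambda>t. max 0 (p t)) has_integral I) {0..2*pi}"
    and J: "((\<lambda>t. max 0 (- p t)) has_integral J) {0..2*pi}"
    unfolding I_def J_def
    by (auto intro!: integrable_integral integrable_continuous_real continuous_intros cont)
  have "((\<lambda>t. max 0 (p t) - max 0 (- p t)) has_integral (I - J)) {0..2*pi}"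
    by (rule has_integral_diff[OF I J])
  moreover have "(\<lambda>t. max 0 (p t) - max 0 (- p t)) = p" by (auto simp: max_def)
  ultimately have IJ: "I - J = 2 * pi * c"
    using has_integral_unique[OF _ int] by simp
  have "I \<ge> 0" by (rule has_integral_nonneg[OF I]) simp
  have "J \<ge> 0" by (rule has_integral_nonneg[OF J]) simp
  have 1: "(\<integral>\<^sup>+ t. e2ennreal (f t) * indicator {0..2*pi} t \<partial>lborel) \<le> ennreal I"
  proof -
    have "(\<integral>\<^sup>+ t. e2ennreal (f t) * indicator {0..2*pi} t \<partial>lborel)
        \<le> (\<integral>\<^sup>+ t. ennreal (indicator {0..2*pi} t * max 0 (p t)) \<partial>lborel)"
    proof (intro nn_integral_mono)
      fix t
      from e2ennreal_mono[OF le[of t]]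
      show "e2ennreal (f t) * indicator {0..2*pi} t \<le> ennreal (indicator {0..2*pi} t * max 0 (p t))"
        by (auto simp: indicator_def max_def ennreal_neg)
    qed
    also have "\<dots> = ennreal I"
      by (rule nn_integral_has_integral_lebesgue[OF _ I]) auto
    finally show ?thesis .
  qed
  have 2: "ennreal J \<le> (\<integral>\<^sup>+ t. e2ennreal (- f t) * indicator {0..2*pi} t \<partial>lborel)"
  proof -
    have "ennreal J = (\<integral>\<^sup>+ t. ennreal (indicator {0..2*pi} t * max 0 (- p t)) \<partial>lborel)"
      by (rule nn_integral_has_integral_lebesgue[OF _ J, symmetric]) auto
    also have "\<dots> \<le> (\<integral>\<^sup>+ t. e2ennreal (- f t) * indicator {0..2*pi} t \<partial>lborel)"
    proof (intro nn_integral_mono)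
      fix t
      have "- ereal (p t) \<le> - f t" using le[of t] by (simp only: ereal_minus_le_minus)
      from e2ennreal_mono[OF this]
      show "ennreal (indicator {0..2*pi} t * max 0 (- p t)) \<le> e2ennreal (- f t) * indicator {0..2*pi} t"
        by (auto simp: indicator_def max_def ennreal_neg)
    qed
    finally show ?thesis .
  qed
  have "enn2ereal (\<integral>\<^sup>+ t. e2ennreal (f t) * indicator {0..2*pi} t \<partial>lborel)
      - enn2ereal (\<integral>\<^sup>+ t. e2ennreal (- f t) * indicator {0..2*pi} t \<partial>lborel)
      \<le> enn2ereal (ennreal I) - enn2ereal (ennreal J)"
    using 1 2 by (intro ereal_minus_mono) (auto simp: less_eq_ennreal.rep_eq)
  also have "\<dots> = ereal (2 * pi * c)"
    using \<open>I \<ge> 0\<close> \<open>J \<ge> 0\<close> IJ by (simp add: enn2ereal_ennreal)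
  finally have "circle_mean f \<le> ereal (2 * pi * c) / ereal (2 * pi)"
    unfolding circle_mean_def by (intro ereal_divide_right_mono) auto
  then show ?thesis by simp
qed

text \<open>Circle means are traded for a comparison with harmonic majorants \<open>Re H\<close>;
  later arguments use the submean inequality only in this form.\<close>

lemma psh_on_le_holomorphic:
  assumes psh: "psh_on \<Omega> u" and disc: "\<And>\<xi>. cmod \<xi> \<le> 1 \<Longrightarrow> cline a b c d \<xi> \<in> \<Omega>"
    and H: "H holomorphic_on cball 0 1"
    and le: "\<And>\<xi>. cmod \<xi> = 1 \<Longrightarrow> u (cline a b c d \<xi>) \<le> ereal (Re (H \<xi>))"
  shows "u (cline a b c d 0) \<le> ereal (Re (H 0))"
proof -
  have "u (cline a b c d 0) \<le> circle_mean (\<lambda>t. u (cline a b c d (cis t)))"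
    using psh disc by (auto simp: psh_on_def)
  also have "\<dots> \<le> ereal (Re (H 0))"
  proof (rule circle_mean_le)
    show "u (cline a b c d (cis t)) \<le> ereal (Re (H (cis t)))" for t
      by (intro le) auto
    show "continuous_on {0..2*pi} (\<lambda>t. Re (H (cis t)))"
      by (intro continuous_intros continuous_on_compose2[OF holomorphic_on_imp_continuous_on[OF H]])
        auto
    have "((\<lambda>t. Re (H (cis t))) has_integral Re (2 * pi * H 0)) {0..2*pi}"
      using has_integral_Re[OF has_integral_circle_mean_value[OF H]] by simp
    then show "((\<lambda>t. Re (H (cis t))) has_integral 2 * pi * Re (H 0)) {0..2*pi}"
      by simp
  qed
  finally show ?thesis .
qed

section \<open>A maximum principle along holomorphic graphs\<close>

text \<open>A two-dimensional slice of \<open>u\<close> in abstract form. The submean property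
  speaks only of discs in lines that are graphs over the first variable, since these include the
  tangent lines of holomorphic graphs.\<close>

locale affine_submean =
  fixes X :: "complex set" and v :: "complex \<times> complex \<Rightarrow> ereal"
  assumes usc: "usc_on (X \<times> ball 0 1) v"
    and nonpos: "\<And>x. x \<in> X \<times> ball 0 1 \<Longrightarrow> v x \<le> 0"
    and submean: "\<And>\<zeta> w \<alpha> r H. \<lbrakk>0 < r; \<And>\<xi>. cmod \<xi> \<le> r \<Longrightarrow> (\<zeta> + \<xi>, w + \<alpha> * \<xi>) \<in> X \<times> ball 0 1;
      H holomorphic_on cball 0 r;
      \<And>\<xi>. cmod \<xi> = r \<Longrightarrow> v (\<zeta> + \<xi>, w + \<alpha> * \<xi>) \<le> ereal (Re (H \<xi>))\<rbrakk>
      \<Longrightarrow> v (\<zeta>, w) \<le> ereal (Re (H 0))"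
begin

text \<open>
  Along the affine line in direction \<open>(1, g'(\<zeta>\<^sub>0))\<close> the penalty \<open>|w - g \<zeta>|\<^sup>2\<close> is the squared modulus of a
  holomorphic function with vanishing derivative, so its circle means grow only like \<open>o(r\<^sup>2)\<close>,
  which the term \<open>-\<epsilon> |\<zeta>|\<^sup>2\<close> beats.
\<close>
lemma no_penalised_interior_maximum:
  assumes r0: "r0 > 0" and sub: "ball \<zeta>0 r0 \<times> ball w0 r0 \<subseteq> X \<times> ball 0 1"
    and g: "g holomorphic_on ball \<zeta>0 r0" and Q: "Q holomorphic_on ball \<zeta>0 r0"
    and pos: "\<epsilon> > 0" "n \<ge> 0"
    and v0: "v (\<zeta>0, w0) = ereal v0"
    and max: "\<And>\<zeta> w. \<zeta> \<in> ball \<zeta>0 r0 \<Longrightarrow> w \<in> ball w0 r0 \<Longrightarrow>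
       v (\<zeta>, w) + ereal (- Re (Q \<zeta>) + \<epsilon> * (cmod \<zeta>)\<^sup>2 - n * (cmod (w - g \<zeta>))\<^sup>2)
       \<le> ereal (v0 + (- Re (Q \<zeta>0) + \<epsilon> * (cmod \<zeta>0)\<^sup>2 - n * (cmod (w0 - g \<zeta>0))\<^sup>2))"
  shows False
proof -
  define \<alpha> where "\<alpha> = deriv g \<zeta>0"
  \<comment> \<open>The linearisation error of \<open>g\<close> will cost at most
    \<open>n * \<eta>\<^sup>2 * r\<^sup>2\<close>; this choice keeps it below the gain
    \<open>\<epsilon> * r\<^sup>2\<close>.\<close>
  define \<eta> where "\<eta> = sqrt (\<epsilon> / (2 * (n + 1)))"
  have \<eta>: "\<eta> > 0" "n * \<eta>\<^sup>2 < \<epsilon>"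
    using pos by (auto simp: \<eta>_def field_simps intro: add_nonneg_pos)
  have "(g has_field_derivative \<alpha>) (at \<zeta>0)"
    unfolding \<alpha>_def using g r0 by (intro holomorphic_derivI[of g "ball \<zeta>0 r0"]) auto
  then have "(g has_derivative (*) \<alpha>) (at \<zeta>0)"
    by (simp add: has_field_derivative_def)
  then obtain d where d: "d > 0"
      "\<And>y. cmod (y - \<zeta>0) < d \<Longrightarrow> cmod (g y - g \<zeta>0 - \<alpha> * (y - \<zeta>0)) \<le> \<eta> * cmod (y - \<zeta>0)"
    unfolding has_derivative_at_alt using \<eta>(1) by metis
  \<comment> \<open>The three bounds serve the error estimate, the first coordinate and the second
    coordinate, which moves by \<open>cmod \<alpha> * r\<close>. The \<open>+ 1\<close> covers
    \<open>\<alpha> = 0\<close>.\<close>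
  define r where "r = min d (min r0 (r0 / (cmod \<alpha> + 1))) / 2"
  have "r > 0" using d(1) r0 by (auto simp: r_def add_nonneg_pos)
  have "r < d" using d(1) r0 by (auto simp: r_def min_def field_simps add_nonneg_pos)
  have "r < r0" using d(1) r0 by (auto simp: r_def min_def field_simps add_nonneg_pos)
  have r\<alpha>: "cmod \<alpha> * r < r0"
  proof -
    have "r < r0 / (cmod \<alpha> + 1)"
      using \<open>r > 0\<close> unfolding r_def by linarith
    then have "r * (cmod \<alpha> + 1) < r0"
      by (simp add: pos_less_divide_eq add_nonneg_pos)
    then show ?thesis using \<open>r > 0\<close> by (simp add: algebra_simps)
  qed
  define E where "E \<xi> = \<alpha> * \<xi> - (g (\<zeta>0 + \<xi>) - g \<zeta>0)" for \<xi>
  define F0 where "F0 = w0 - g \<zeta>0"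
  define c0 where "c0 = v0 + (- Re (Q \<zeta>0) + \<epsilon> * (cmod \<zeta>0)\<^sup>2 - n * (cmod (w0 - g \<zeta>0))\<^sup>2)"
  \<comment> \<open>\<open>Re H\<close> comes from solving \<open>max\<close> for \<open>v\<close>
    on the circle and expanding both squares there: the cross terms are real parts of holomorphic
    functions, and the pure squares are replaced by the constant \<open>r\<^sup>2\<close> and the
    bound \<open>\<eta>\<^sup>2 * r\<^sup>2\<close>.\<close>
  define H where "H \<xi> = of_real c0 + Q (\<zeta>0 + \<xi>)
      - of_real \<epsilon> * (of_real ((cmod \<zeta>0)\<^sup>2 + r\<^sup>2) + 2 * cnj \<zeta>0 * \<xi>)
      + of_real n * (of_real ((cmod F0)\<^sup>2 + \<eta>\<^sup>2 * r\<^sup>2) + 2 * cnj F0 * E \<xi>)" for \<xi>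
  have inb: "\<zeta>0 + \<xi> \<in> ball \<zeta>0 r0" "w0 + \<alpha> * \<xi> \<in> ball w0 r0" if "cmod \<xi> \<le> r" for \<xi>
  proof -
    show "\<zeta>0 + \<xi> \<in> ball \<zeta>0 r0" using that \<open>r < r0\<close> by (simp add: dist_norm)
    have "cmod (\<alpha> * \<xi>) \<le> cmod \<alpha> * r" using that by (simp add: norm_mult mult_left_mono)
    then show "w0 + \<alpha> * \<xi> \<in> ball w0 r0" using r\<alpha> by (simp add: dist_norm)
  qed
  have "v (\<zeta>0, w0) \<le> ereal (Re (H 0))"
  proof (rule submean[where \<alpha> = \<alpha> and r = r])
    show "0 < r" by fact
    show "(\<zeta>0 + \<xi>, w0 + \<alpha> * \<xi>) \<in> X \<times> ball 0 1" if "cmod \<xi> \<le> r" for \<xi>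
      using inb[OF that] sub by blast
    have img: "(\<lambda>\<xi>. \<zeta>0 + \<xi>) ` cball 0 r \<subseteq> ball \<zeta>0 r0"
      using \<open>r < r0\<close> by (auto simp: dist_norm)
    have gc: "(\<lambda>\<xi>. g (\<zeta>0 + \<xi>)) holomorphic_on cball 0 r"
      by (rule holomorphic_on_compose_gen[OF _ g img, unfolded o_def]) (intro holomorphic_intros)
    have Qc: "(\<lambda>\<xi>. Q (\<zeta>0 + \<xi>)) holomorphic_on cball 0 r"
      by (rule holomorphic_on_compose_gen[OF _ Q img, unfolded o_def]) (intro holomorphic_intros)
    show "H holomorphic_on cball 0 r"
      unfolding H_def E_def by (intro holomorphic_intros gc Qc)
    show "v (\<zeta>0 + \<xi>, w0 + \<alpha> * \<xi>) \<le> ereal (Re (H \<xi>))" if \<xi>: "cmod \<xi> = r" for \<xi>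
    proof -
      let ?k = "- Re (Q (\<zeta>0 + \<xi>)) + \<epsilon> * (cmod (\<zeta>0 + \<xi>))\<^sup>2 - n * (cmod (w0 + \<alpha> * \<xi> - g (\<zeta>0 + \<xi>)))\<^sup>2"
      have "v (\<zeta>0 + \<xi>, w0 + \<alpha> * \<xi>) + ereal ?k \<le> ereal c0"
        unfolding c0_def using inb[of \<xi>] \<xi> by (intro max) auto
      then have 1: "v (\<zeta>0 + \<xi>, w0 + \<alpha> * \<xi>) \<le> ereal (c0 - ?k)"
        by (cases "v (\<zeta>0 + \<xi>, w0 + \<alpha> * \<xi>)") auto
      have sq: "(cmod (x + y))\<^sup>2 = (cmod x)\<^sup>2 + (cmod y)\<^sup>2 + Re (2 * cnj x * y)" for x y
        unfolding cmod_power2 by (simp add: power2_eq_square algebra_simps)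
      have "cmod (E \<xi>) \<le> \<eta> * r"
        using d(2)[of "\<zeta>0 + \<xi>"] \<xi> \<open>r < d\<close> by (simp add: E_def norm_minus_commute algebra_simps)
      then have E: "(cmod (E \<xi>))\<^sup>2 \<le> \<eta>\<^sup>2 * r\<^sup>2"
        using power_mono[of "cmod (E \<xi>)" "\<eta> * r" 2] by (simp add: power_mult_distrib)
      have "w0 + \<alpha> * \<xi> - g (\<zeta>0 + \<xi>) = F0 + E \<xi>" by (simp add: F0_def E_def)
      then have "(cmod (w0 + \<alpha> * \<xi> - g (\<zeta>0 + \<xi>)))\<^sup>2
          \<le> (cmod F0)\<^sup>2 + \<eta>\<^sup>2 * r\<^sup>2 + Re (2 * cnj F0 * E \<xi>)"
        using E by (simp only: sq)
      then have A: "n * (cmod (w0 + \<alpha> * \<xi> - g (\<zeta>0 + \<xi>)))\<^sup>2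
          \<le> n * ((cmod F0)\<^sup>2 + \<eta>\<^sup>2 * r\<^sup>2 + Re (2 * cnj F0 * E \<xi>))"
        using pos(2) by (rule mult_left_mono)
      have B: "(cmod (\<zeta>0 + \<xi>))\<^sup>2 = (cmod \<zeta>0)\<^sup>2 + r\<^sup>2 + Re (2 * cnj \<zeta>0 * \<xi>)"
        by (simp only: sq \<xi>)
      have ReH: "Re (H \<xi>) = c0 + Re (Q (\<zeta>0 + \<xi>)) - \<epsilon> * ((cmod \<zeta>0)\<^sup>2 + r\<^sup>2 + Re (2 * cnj \<zeta>0 * \<xi>))
          + n * ((cmod F0)\<^sup>2 + \<eta>\<^sup>2 * r\<^sup>2 + Re (2 * cnj F0 * E \<xi>))"
      proof -
        have "Re (of_real t * z) = t * Re z" for t z by simp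
        then show ?thesis
          unfolding H_def by (simp only: plus_complex.sel minus_complex.sel Re_complex_of_real)
      qed
      have "c0 - ?k \<le> Re (H \<xi>)"
        unfolding ReH using A B by simp
      then show ?thesis using 1 order_trans by (metis ereal_less_eq(3))
    qed
  qed
  \<comment> \<open>Since \<open>E 0 = 0\<close>, the cross terms vanish at the centre and the
    majorant falls strictly below \<open>v0\<close>.\<close>
  moreover have "Re (H 0) = v0 - (\<epsilon> - n * \<eta>\<^sup>2) * r\<^sup>2"
    by (simp add: H_def E_def c0_def F0_def algebra_simps)
  moreover have "(\<epsilon> - n * \<eta>\<^sup>2) * r\<^sup>2 > 0" using \<eta> \<open>r > 0\<close> by simp
  ultimately show False using v0 by simp
qed

lemma graph_maximum_principle:
  fixes g :: "complex \<Rightarrow> complex" and q :: "complex \<Rightarrow> real"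
  assumes G: "open G" "bounded G" "closure G \<subseteq> X"
    and g: "g holomorphic_on G" "continuous_on (closure G) g" "\<And>\<zeta>. \<zeta> \<in> closure G \<Longrightarrow> cmod (g \<zeta>) < 1"
    and q: "continuous_on (closure G) q"
      "\<And>\<zeta>. \<zeta> \<in> G \<Longrightarrow> \<exists>r>0. \<exists>Q. Q holomorphic_on ball \<zeta> r \<and> (\<forall>\<xi>\<in>ball \<zeta> r. q \<xi> = Re (Q \<xi>))"
    and bd: "\<And>\<zeta>. \<zeta> \<in> frontier G \<Longrightarrow> v (\<zeta>, g \<zeta>) \<le> ereal (q \<zeta>)"
    and \<zeta>1: "\<zeta>1 \<in> G"
  shows "v (\<zeta>1, g \<zeta>1) \<le> ereal (q \<zeta>1)"
proof (rule ccontr)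
  assume "\<not> ?thesis"
  then have gt: "ereal (q \<zeta>1) < v (\<zeta>1, g \<zeta>1)" by simp
  have cl: "\<zeta>1 \<in> closure G" using \<zeta>1 closure_subset by blast
  then have "v (\<zeta>1, g \<zeta>1) \<le> 0" using G(3) g(3) by (intro nonpos) auto
  with gt obtain v1 where v1: "v (\<zeta>1, g \<zeta>1) = ereal v1" by (cases "v (\<zeta>1, g \<zeta>1)") auto
  define \<sigma> where "\<sigma> = v1 - q \<zeta>1"
  have "\<sigma> > 0" using gt v1 by (simp add: \<sigma>_def)
  have comp: "compact (closure G)" using G(2) by (simp add: compact_closure)
  obtain b where b: "b > 0" "\<And>\<zeta>. \<zeta> \<in> closure G \<Longrightarrow> cmod \<zeta> \<le> b"
    using compact_imp_bounded[OF comp] bounded_pos by metis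
  \<comment> \<open>The quadratic term may use up at most half of the excess
    \<open>\<sigma>\<close>.\<close>
  define \<epsilon> where "\<epsilon> = \<sigma> / (2 * b\<^sup>2)"
  have "\<epsilon> > 0" using \<open>\<sigma> > 0\<close> b by (simp add: \<epsilon>_def)
  have \<epsilon>b: "\<epsilon> * (cmod \<zeta>)\<^sup>2 \<le> \<sigma> / 2" if "\<zeta> \<in> closure G" for \<zeta>
  proof -
    have "\<epsilon> * (cmod \<zeta>)\<^sup>2 \<le> \<epsilon> * b\<^sup>2"
      using b(2)[OF that] \<open>\<epsilon> > 0\<close> by (intro mult_left_mono power_mono) auto
    also have "\<dots> = \<sigma> / 2" using b(1) by (simp add: \<epsilon>_def)
    finally show ?thesis .
  qed
  have "continuous_on (closure G) (\<lambda>\<zeta>. cmod (g \<zeta>))" by (intro continuous_intros g)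
  with comp cl have "\<exists>\<zeta>m\<in>closure G. \<forall>\<zeta>\<in>closure G. cmod (g \<zeta>) \<le> cmod (g \<zeta>m)"
    by (intro continuous_attains_sup) auto
  then obtain \<zeta>m where \<zeta>m: "\<zeta>m \<in> closure G" "\<And>\<zeta>. \<zeta> \<in> closure G \<Longrightarrow> cmod (g \<zeta>) \<le> cmod (g \<zeta>m)"
    by metis
  \<comment> \<open>Compactness keeps the graph strictly inside a smaller disc, so \<open>K\<close>
    is a compact part of the domain and the graph stays off the outer edge of
    \<open>K\<close>.\<close>
  obtain \<rho> where \<rho>: "cmod (g \<zeta>m) < \<rho>" "\<rho> < 1" using g(3)[OF \<zeta>m(1)] dense by blast
  have g\<rho>: "cmod (g \<zeta>) < \<rho>" if "\<zeta> \<in> closure G" for \<zeta> using \<zeta>m(2)[OF that] \<rho> by simp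
  define K where "K = closure G \<times> cball (0::complex) \<rho>"
  have "compact K" unfolding K_def by (intro compact_Times comp) auto
  have K1: "(\<zeta>1, g \<zeta>1) \<in> K" using cl g\<rho>[OF cl] by (auto simp: K_def)
  have KS: "K \<subseteq> X \<times> ball 0 1" using G(3) \<rho> by (auto simp: K_def)
  define k where "k n x = - q (fst x) + \<epsilon> * (cmod (fst x))\<^sup>2 - real n * (cmod (snd x - g (fst x)))\<^sup>2"
    for n :: nat and x :: "complex \<times> complex"
  have contK: "continuous_on K (\<lambda>x. q (fst x))" "continuous_on K (\<lambda>x. g (fst x))"
    by (auto intro!: continuous_on_compose2[OF q(1)] continuous_on_compose2[OF g(2)] continuous_intros simp: K_def)
  have "continuous_on K (k n)" for n
    unfolding k_def by (intro continuous_intros contK)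
  then have uscK: "usc_on K (\<lambda>x. v x + ereal (k n x))" for n
    by (intro usc_on_add_continuous usc_on_subset[OF usc KS])
  have "\<exists>x\<in>K. \<forall>y\<in>K. v y + ereal (k n y) \<le> v x + ereal (k n x)" for n
  proof -
    obtain x where "x \<in> K" "\<And>y. y \<in> K \<Longrightarrow> v y + ereal (k n y) \<le> v x + ereal (k n x)"
      using usc_on_attains_sup[OF \<open>compact K\<close> _ uscK[of n]] K1 by (metis empty_iff)
    then show ?thesis by metis
  qed
  then obtain x where xK: "\<And>n. x n \<in> K"
    and xmax: "\<And>n y. y \<in> K \<Longrightarrow> v y + ereal (k n y) \<le> v (x n) + ereal (k n (x n))"
    by metis
  \<comment> \<open>On the graph over \<open>\<zeta>1\<close> the penalty vanishes and the penalised
    value is at least \<open>\<sigma>\<close>. Every maximum inherits this bound, which also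
    excludes \<open>v (x n) = -\<infinity>\<close>.\<close>
  have xge: "\<exists>vn. v (x n) = ereal vn \<and> vn \<le> 0 \<and> \<sigma> \<le> vn + k n (x n)" for n
  proof -
    have "ereal (v1 + k n (\<zeta>1, g \<zeta>1)) \<le> v (x n) + ereal (k n (x n))"
      using xmax[OF K1, of n] v1 by simp
    moreover have "v1 + k n (\<zeta>1, g \<zeta>1) \<ge> \<sigma>"
      using \<open>\<epsilon> > 0\<close> by (simp add: k_def \<sigma>_def)
    moreover have "v (x n) \<le> 0" using xK KS nonpos by blast
    ultimately show ?thesis by (cases "v (x n)") auto
  qed
  obtain vv where vv: "\<And>n. v (x n) = ereal (vv n)" "\<And>n. vv n \<le> 0" "\<And>n. \<sigma> \<le> vv n + k n (x n)"
    using xge by metis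
  obtain C where C: "\<And>\<zeta>. \<zeta> \<in> closure G \<Longrightarrow> \<bar>q \<zeta>\<bar> \<le> C"
    using compact_imp_bounded[OF compact_continuous_image[OF q(1) comp]]
    by (auto simp: bounded_iff)
  \<comment> \<open>In \<open>\<sigma> \<le> vv n + k n (x n)\<close> everything except the penalty
    is at most \<open>C + \<sigma> / 2\<close>, so \<open>n\<close> times the squared distance in
    the fibre is at most \<open>C\<close>.\<close>
  have pen: "(cmod (snd (x n) - g (fst (x n))))\<^sup>2 \<le> C * inverse (real n)" if "n > 0" for n
  proof -
    have f: "fst (x n) \<in> closure G" using xK[of n] by (auto simp: K_def)
    have "real n * (cmod (snd (x n) - g (fst (x n))))\<^sup>2 \<le> C"
      using vv(2,3)[of n] C[OF f] \<epsilon>b[OF f] \<open>\<sigma> > 0\<close> unfolding k_def by linarith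
    then show ?thesis using that by (simp add: field_simps)
  qed
  obtain xs s where xs: "xs \<in> K" "strict_mono s" "(x \<circ> s) \<longlonglongrightarrow> xs"
    using \<open>compact K\<close> xK unfolding compact_def by metis
  obtain \<zeta>s ws where xs_eq: "xs = (\<zeta>s, ws)" by (cases xs)
  have s_top: "filterlim s at_top sequentially" by (rule filterlim_subseq[OF xs(2)])
  have lim1: "(\<lambda>j. fst (x (s j))) \<longlonglongrightarrow> \<zeta>s" and lim2: "(\<lambda>j. snd (x (s j))) \<longlonglongrightarrow> ws"
    using tendsto_fst[OF xs(3)] tendsto_snd[OF xs(3)] by (auto simp: xs_eq)
  have \<zeta>s: "\<zeta>s \<in> closure G" using xs(1) by (auto simp: K_def xs_eq)
  have xcl: "fst (x n) \<in> closure G" for n using xK[of n] by (auto simp: K_def)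
  have limg: "(\<lambda>j. g (fst (x (s j)))) \<longlonglongrightarrow> g \<zeta>s" and limq: "(\<lambda>j. q (fst (x (s j)))) \<longlonglongrightarrow> q \<zeta>s"
    using continuous_on_tendsto_compose[OF g(2) lim1 \<zeta>s] continuous_on_tendsto_compose[OF q(1) lim1 \<zeta>s] xcl
    by auto
  have "(\<lambda>j. (cmod (snd (x (s j)) - g (fst (x (s j)))))\<^sup>2) \<longlonglongrightarrow> (cmod (ws - g \<zeta>s))\<^sup>2"
    by (intro tendsto_intros lim2 limg)
  moreover have "(\<lambda>j. C * inverse (real (s j))) \<longlonglongrightarrow> C * 0"
    by (intro tendsto_intros filterlim_compose[OF lim_inverse_n s_top])
  moreover have "eventually (\<lambda>j. (cmod (snd (x (s j)) - g (fst (x (s j)))))\<^sup>2 \<le> C * inverse (real (s j))) sequentially"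
    using eventually_compose_filterlim[OF eventually_gt_at_top[of 0] s_top]
    by eventually_elim (rule pen)
  ultimately have "(cmod (ws - g \<zeta>s))\<^sup>2 \<le> C * 0"
    by (intro tendsto_le[OF sequentially_bot]) auto
  then have ws: "ws = g \<zeta>s" by simp
  \<comment> \<open>Over the frontier, \<open>v\<close> would eventually be below
    \<open>q \<zeta>s + \<sigma> / 4\<close>, \<open>- q\<close> below
    \<open>- q \<zeta>s + \<sigma> / 4\<close>, and the quadratic term at most
    \<open>\<sigma> / 2\<close>: the penalised maximum would be less than
    \<open>\<sigma>\<close>.\<close>
  have "\<zeta>s \<in> G"
  proof (rule ccontr)
    assume "\<zeta>s \<notin> G"
    then have "v xs \<le> ereal (q \<zeta>s)"
      using \<zeta>s G(1) bd[of \<zeta>s] ws xs_eq by (auto simp: frontier_def interior_open)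
    also have "\<dots> < ereal (q \<zeta>s + \<sigma> / 4)" using \<open>\<sigma> > 0\<close> by simp
    finally obtain d where d: "d > 0" "\<And>y. y \<in> K \<Longrightarrow> dist y xs < d \<Longrightarrow> v y < ereal (q \<zeta>s + \<sigma> / 4)"
      using usc_onD[OF usc_on_subset[OF usc KS] xs(1)] by metis
    have "eventually (\<lambda>j. dist (x (s j)) xs < d) sequentially"
      using xs(3) d(1) by (auto simp: tendsto_iff)
    moreover have "eventually (\<lambda>j. q (fst (x (s j))) > q \<zeta>s - \<sigma> / 4) sequentially"
      using limq \<open>\<sigma> > 0\<close> by (intro order_tendstoD) auto
    ultimately have "eventually (\<lambda>j::nat. False) sequentially"
    proof eventually_elim
      case (elim j)
      have "vv (s j) < q \<zeta>s + \<sigma> / 4" using d(2)[OF xK elim(1)] vv(1) by simp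
      moreover have "0 \<le> real (s j) * (cmod (snd (x (s j)) - g (fst (x (s j)))))\<^sup>2" by simp
      then have "k (s j) (x (s j)) \<le> - q (fst (x (s j))) + \<sigma> / 2"
        unfolding k_def using \<epsilon>b[OF xcl[of "s j"]] by linarith
      ultimately show False using vv(3)[of "s j"] elim(2) by linarith
    qed
    then show False by simp
  qed
  \<comment> \<open>A single index whose maximum point is interior to \<open>K\<close> suffices for
    the contradiction.\<close>
  have "eventually (\<lambda>j. fst (x (s j)) \<in> G) sequentially"
    using topological_tendstoD[OF lim1 G(1) \<open>\<zeta>s \<in> G\<close>] .
  moreover have "eventually (\<lambda>j. snd (x (s j)) \<in> ball 0 \<rho>) sequentially"
    using g\<rho>[OF \<zeta>s] ws by (intro topological_tendstoD[OF lim2]) auto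
  ultimately have "eventually (\<lambda>j. fst (x (s j)) \<in> G \<and> snd (x (s j)) \<in> ball 0 \<rho>) sequentially"
    by (rule eventually_conj)
  then obtain j where "fst (x (s j)) \<in> G" "snd (x (s j)) \<in> ball 0 \<rho>"
    using eventually_happens'[OF sequentially_bot] by blast
  then obtain n \<zeta>0 w0 where n: "x n = (\<zeta>0, w0)" "\<zeta>0 \<in> G" "w0 \<in> ball 0 \<rho>"
    by (metis prod.collapse)
  obtain r1 Q where r1: "r1 > 0" "Q holomorphic_on ball \<zeta>0 r1" "\<And>\<xi>. \<xi> \<in> ball \<zeta>0 r1 \<Longrightarrow> q \<xi> = Re (Q \<xi>)"
    using q(2)[OF n(2)] by blast
  obtain r2 where r2: "r2 > 0" "ball \<zeta>0 r2 \<subseteq> G" using G(1) n(2) openE by blast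
  obtain r3 where r3: "r3 > 0" "ball w0 r3 \<subseteq> ball 0 \<rho>" using n(3) by (meson open_ball open_contains_ball)
  define r where "r = min r1 (min r2 r3)"
  have r: "r > 0" "ball \<zeta>0 r \<subseteq> ball \<zeta>0 r1" "ball \<zeta>0 r \<subseteq> G" "ball w0 r \<subseteq> ball 0 \<rho>"
    using r1(1) r2 r3 by (auto simp: r_def)
  have sub: "ball \<zeta>0 r \<times> ball w0 r \<subseteq> K"
    using r(3,4) closure_subset[of G] unfolding K_def by fastforce
  show False
  proof (rule no_penalised_interior_maximum)
    show "r > 0" by fact
    show "ball \<zeta>0 r \<times> ball w0 r \<subseteq> X \<times> ball 0 1" using sub KS by blast
    show "g holomorphic_on ball \<zeta>0 r" using g(1) r(3) by (rule holomorphic_on_subset)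
    show "Q holomorphic_on ball \<zeta>0 r" using r1(2) r(2) by (rule holomorphic_on_subset)
    show "\<epsilon> > 0" "real n \<ge> 0" using \<open>\<epsilon> > 0\<close> by auto
    show "v (\<zeta>0, w0) = ereal (vv n)" using vv(1)[of n] n(1) by simp
    show "v (\<zeta>, w) + ereal (- Re (Q \<zeta>) + \<epsilon> * (cmod \<zeta>)\<^sup>2 - real n * (cmod (w - g \<zeta>))\<^sup>2)
       \<le> ereal (vv n + (- Re (Q \<zeta>0) + \<epsilon> * (cmod \<zeta>0)\<^sup>2 - real n * (cmod (w0 - g \<zeta>0))\<^sup>2))"
      if "\<zeta> \<in> ball \<zeta>0 r" "w \<in> ball w0 r" for \<zeta> w
    proof -
      have "(\<zeta>, w) \<in> K" using sub that by blast
      moreover have "q \<zeta> = Re (Q \<zeta>)" "q \<zeta>0 = Re (Q \<zeta>0)" using r1 r(2) that(1) by auto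
      ultimately show ?thesis
        using xmax[of "(\<zeta>, w)" n] vv(1)[of n] by (simp add: k_def n(1))
    qed
  qed
qed

end

section \<open>Lelong numbers of the slices\<close>

lemma norm_vector_scalar_mult: "norm (w *s e) = cmod w * norm (e :: complex ^ 'm)"
  unfolding norm_vec_def vector_scalar_mult_def by (simp add: norm_mult L2_set_right_distrib)

lemma cline_eq: "cline a b c d \<zeta> = (a + \<zeta> *s c, b + \<zeta> *s d)"
  by (simp add: cline_def vec_eq_iff)

lemma continuous_on_vector_scalar_mult [continuous_intros]:
  fixes e :: "complex ^ 'm"
  shows "continuous_on S f \<Longrightarrow> continuous_on S (\<lambda>x. f x *s e)"
  unfolding vector_scalar_mult_def by (intro continuous_intros)

lemma open_polydisc: "open (polydisc :: (complex ^ 'k) set)"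
proof -
  have "polydisc = (\<Inter>i. {z :: complex ^ 'k. cmod (z $ i) < 1})" by (auto simp: polydisc_def)
  moreover have "open {z :: complex ^ 'k. cmod (z $ i) < 1}" for i
    by (intro open_Collect_less continuous_intros)
  ultimately show ?thesis by (metis open_INT finite_class.finite_UNIV)
qed

lemma convex_polydisc: "convex (polydisc :: (complex ^ 'k) set)"
proof -
  have "polydisc = (\<Inter>i. (\<lambda>z :: complex ^ 'k. z $ i) -` ball 0 1)" by (auto simp: polydisc_def)
  moreover have "convex ((\<lambda>z :: complex ^ 'k. z $ i) -` ball 0 1)" for i
    by (intro convex_linear_vimage bounded_linear.linear bounded_linear_vec_nth) auto
  ultimately show ?thesis by (metis convex_INT)
qed

lemma ball_subset_polydisc: "ball 0 1 \<subseteq> (polydisc :: (complex ^ 'k) set)"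
  using Finite_Cartesian_Product.norm_nth_le by (fastforce simp: polydisc_def intro: le_less_trans)

section \<open>Inequalities between extended reals\<close>

lemma ereal_le_divide_neg_iff:
  assumes "x < 0" "S \<le> 0"
  shows "ereal l \<le> S / ereal x \<longleftrightarrow> S \<le> ereal (l * x)"
proof (cases S)
  case (real s)
  then show ?thesis using assms by (simp add: neg_le_divide_eq)
next
  case MInf
  have "- \<infinity> / ereal x = \<infinity>" using assms by (simp add: divide_ereal_def)
  then show ?thesis using MInf by simp
qed (use assms in auto)

text \<open>Testing against finite levels \<open>l\<close> lets infinite logarithmic quotients be
  handled by real bounds \<open>l * ln r\<close>.\<close>

lemma ereal_leI_nonneg_real:
  assumes "0 \<le> y" "\<And>l. 0 \<le> l \<Longrightarrow> ereal l \<le> x \<Longrightarrow> ereal l \<le> y"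
  shows "x \<le> y"
proof (rule ccontr)
  assume "\<not> x \<le> y"
  then obtain l where l: "y < ereal l" "ereal l < x" using ereal_dense2 by (meson not_le)
  then have "0 \<le> l" using assms(1) by (metis ereal_less_eq(5) less_imp_le order_trans)
  then show False using assms(2)[of l] l by (meson less_imp_le not_le)
qed

section \<open>Slices of a nonpositive plurisubharmonic function\<close>

locale nonpos_psh =
  fixes u :: "(complex ^ 'k) \<times> (complex ^ 'm) \<Rightarrow> ereal"
  assumes psh: "psh_on (polydisc \<times> polydisc) u"
    and u_nonpos: "\<And>z. z \<in> polydisc \<times> polydisc \<Longrightarrow> u z \<le> 0"
begin

lemma slice_in_polydisc:
  assumes "norm (e :: complex ^ 'm) \<le> 1" "cmod w < 1"
  shows "w *s e \<in> polydisc"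
proof -
  have "norm (w *s e) \<le> cmod w * 1"
    unfolding norm_vector_scalar_mult using assms(1) by (intro mult_left_mono) auto
  then show ?thesis using assms(2) ball_subset_polydisc by fastforce
qed

lemma affine_submean_slice:
  assumes e: "norm e \<le> 1"
  shows "affine_submean {\<zeta>. a + \<zeta> *s c \<in> polydisc} (\<lambda>x. u (a + fst x *s c, snd x *s e))"
proof
  show "usc_on ({\<zeta>. a + \<zeta> *s c \<in> polydisc} \<times> ball 0 1) (\<lambda>x. u (a + fst x *s c, snd x *s e))"
  proof (rule usc_on_compose[where T = "polydisc \<times> polydisc"])
    show "usc_on (polydisc \<times> polydisc) u" using psh by (simp add: psh_on_def)
    show "continuous_on ({\<zeta>. a + \<zeta> *s c \<in> polydisc} \<times> ball 0 1) (\<lambda>x. (a + fst x *s c, snd x *s e))"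
      by (intro continuous_intros)
  qed (use slice_in_polydisc[OF e] in auto)
  show "u (a + fst x *s c, snd x *s e) \<le> 0"
    if "x \<in> {\<zeta>. a + \<zeta> *s c \<in> polydisc} \<times> ball 0 1" for x
    using that slice_in_polydisc[OF e] by (intro u_nonpos) auto
  fix \<zeta> w \<alpha> r H
  assume r: "0 < (r::real)"
    and inX: "\<And>\<xi>. cmod \<xi> \<le> r \<Longrightarrow> (\<zeta> + \<xi>, w + \<alpha> * \<xi>) \<in> {\<zeta>. a + \<zeta> *s c \<in> polydisc} \<times> ball 0 1"
    and H: "H holomorphic_on cball 0 r"
    and le: "\<And>\<xi>. cmod \<xi> = r \<Longrightarrow>
      u (a + fst (\<zeta> + \<xi>, w + \<alpha> * \<xi>) *s c, snd (\<zeta> + \<xi>, w + \<alpha> * \<xi>) *s e) \<le> ereal (Re (H \<xi>))"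
  \<comment> \<open>\<open>psh_on\<close> speaks of the unit circle, so the radius \<open>r\<close>
    is absorbed into the direction of the line and into the argument of \<open>H\<close>.\<close>
  let ?L = "cline (a + \<zeta> *s c) (w *s e) (of_real r *s c) ((\<alpha> * of_real r) *s e)"
  have L: "?L \<xi> = (a + (\<zeta> + of_real r * \<xi>) *s c, (w + \<alpha> * (of_real r * \<xi>)) *s e)" for \<xi>
    by (simp add: cline_eq vec_eq_iff algebra_simps)
  have "u (?L 0) \<le> ereal (Re (H (of_real r * 0)))"
  proof (rule psh_on_le_holomorphic[OF psh, where H = "\<lambda>\<xi>. H (of_real r * \<xi>)"])
    fix \<xi> assume "cmod \<xi> \<le> 1"
    then have "cmod (of_real r * \<xi>) \<le> r" using r by (simp add: norm_mult)
    from inX[OF this] show "?L \<xi> \<in> polydisc \<times> polydisc"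
      unfolding L using slice_in_polydisc[OF e, of "w + \<alpha> * (of_real r * \<xi>)"] by simp
  next
    show "(\<lambda>\<xi>. H (of_real r * \<xi>)) holomorphic_on cball 0 1"
      using r by (intro holomorphic_on_compose_gen[OF _ H, unfolded o_def] holomorphic_intros)
        (auto simp: norm_mult)
  next
    fix \<xi> assume "cmod \<xi> = 1"
    then have "cmod (of_real r * \<xi>) = r" using r by (simp add: norm_mult)
    from le[OF this] show "u (?L \<xi>) \<le> ereal (Re (H (of_real r * \<xi>)))"
      unfolding L by simp
  qed
  then show "u (a + fst (\<zeta>, w) *s c, snd (\<zeta>, w) *s e) \<le> ereal (Re (H 0))"
    unfolding L by simp
qed

text \<open>Hadamard's three circles theorem, with the outer radius tending to 1.\<close>
lemma log_bound_extends:
  assumes z: "z \<in> polydisc" and r: "0 < r" "r < r'" "r' < 1" and l: "0 \<le> l"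
    and bound: "\<And>y. norm y < r \<Longrightarrow> u (z, y) \<le> ereal (l * ln r)" and y: "norm y < r'"
  shows "u (z, y) \<le> ereal (l * ln r')"
proof (cases "norm y < r")
  case True
  have "l * ln r \<le> l * ln r'" using r l by (intro mult_left_mono) auto
  then show ?thesis using bound[OF True] by (meson ereal_less_eq(3) order_trans)
next
  case False
  define e where "e = of_real (1 / norm y) *s y"
  have ny: "norm y > 0" using False r by linarith
  have e: "norm e = 1" using ny by (simp add: e_def norm_vector_scalar_mult norm_divide)
  \<comment> \<open>The base direction is 0, so the first variable is a dummy: with \<open>g\<close>
    the identity, the graph principle becomes a one-variable maximum principle for
    \<open>w \<mapsto> u (z, w e)\<close>.\<close>
  interpret affine_submean "{\<zeta>. z + \<zeta> *s 0 \<in> polydisc}" "\<lambda>x. u (z + fst x *s 0, snd x *s e)"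
    using e by (intro affine_submean_slice) simp
  \<comment> \<open>With this \<open>R\<close>, the function \<open>q\<close> below equals 0 on the
    outer circle of radius \<open>R\<close>, \<open>l * ln r\<close> on the inner circle of radius
    \<open>R * r\<close>, and \<open>l * ln r'\<close> at \<open>norm y\<close>. As
    \<open>R < 1\<close>, the closed annulus stays in the unit disc.\<close>
  define R where "R = norm y / r'"
  have R: "0 < R" "R < 1" "norm y < R" "R * r < norm y"
  proof -
    show "0 < R" "R < 1" using ny y r by (auto simp: R_def)
    show "norm y < R" using ny r by (simp add: R_def field_simps)
    have "R * r < 1 * r" using r \<open>R < 1\<close> by (intro mult_strict_right_mono) auto
    then show "R * r < norm y" using False by simp
  qed
  define G where "G = {\<zeta>. R * r < cmod \<zeta> \<and> cmod \<zeta> < R}"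
  have oG: "open G" unfolding G_def
    by (intro open_Collect_conj open_Collect_less continuous_intros)
  have clG: "closure G \<subseteq> {\<zeta>. R * r \<le> cmod \<zeta> \<and> cmod \<zeta> \<le> R}"
  proof (rule closure_minimal)
    show "closed {\<zeta>. R * r \<le> cmod \<zeta> \<and> cmod \<zeta> \<le> R}"
      by (intro closed_Collect_conj closed_Collect_le continuous_intros)
  qed (auto simp: G_def)
  define q where "q \<zeta> = l * (ln (cmod \<zeta>) - ln R)" for \<zeta> :: complex
  have Rr: "R * r > 0" using R r by simp
  have "u (z + fst (of_real (norm y), of_real (norm y) :: complex) *s 0,
        snd (of_real (norm y) :: complex, of_real (norm y)) *s e) \<le> ereal (q (of_real (norm y)))"
  proof (rule graph_maximum_principle[where g = "\<lambda>\<zeta>. \<zeta>" and G = G])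
    show "open G" by fact
    show "bounded G" by (rule bounded_subset[of "cball 0 R"]) (auto simp: G_def)
    show "closure G \<subseteq> {\<zeta>. z + \<zeta> *s 0 \<in> polydisc}" using z by simp
    show "cmod \<zeta> < 1" if "\<zeta> \<in> closure G" for \<zeta> using that clG R by auto
    show "continuous_on (closure G) q"
      unfolding q_def by (intro continuous_intros) (use clG Rr in auto)
    show "\<exists>\<rho>>0. \<exists>Q. Q holomorphic_on ball \<zeta> \<rho> \<and> (\<forall>\<xi>\<in>ball \<zeta> \<rho>. q \<xi> = Re (Q \<xi>))" if "\<zeta> \<in> G" for \<zeta>
    proof (intro exI conjI ballI)
      \<comment> \<open>A branch of the logarithm centred at \<open>\<zeta>\<close>: on this ball
        \<open>\<xi> / \<zeta>\<close> lies in the right half-plane, and the added constant restores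
        \<open>ln (cmod \<xi>) - ln R\<close>.\<close>
      let ?Q = "\<lambda>\<xi>. of_real l * (Ln (\<xi> / \<zeta>) + of_real (ln (cmod \<zeta>) - ln R))"
      show "cmod \<zeta> > 0" using that Rr by (auto simp: G_def)
      then have \<zeta>0: "\<zeta> \<noteq> 0" by auto
      have pos: "Re (\<xi> / \<zeta>) > 0" if "\<xi> \<in> ball \<zeta> (cmod \<zeta>)" for \<xi>
      proof -
        have "cmod (1 - \<xi> / \<zeta>) = cmod (\<zeta> - \<xi>) / cmod \<zeta>"
          using \<zeta>0 by (simp add: norm_divide[symmetric] diff_divide_distrib)
        also have "\<dots> < 1" using that \<zeta>0 by (simp add: dist_norm)
        finally show ?thesis using abs_Re_le_cmod[of "1 - \<xi> / \<zeta>"] by simp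
      qed
      show "?Q holomorphic_on ball \<zeta> (cmod \<zeta>)"
        using pos \<zeta>0 by (intro holomorphic_intros) (auto simp: complex_nonpos_Reals_iff not_le dest: pos)
      show "q \<xi> = Re (?Q \<xi>)" if "\<xi> \<in> ball \<zeta> (cmod \<zeta>)" for \<xi>
      proof -
        have "\<xi> \<noteq> 0" using pos[OF that] by auto
        then show ?thesis using \<zeta>0 by (simp add: q_def norm_divide ln_div)
      qed
    qed
    show "u (z + fst (\<zeta>, \<zeta>) *s 0, snd (\<zeta>, \<zeta>) *s e) \<le> ereal (q \<zeta>)" if "\<zeta> \<in> frontier G" for \<zeta>
    proof -
      have "\<zeta> \<in> closure G" "\<zeta> \<notin> G" using that oG by (auto simp: frontier_def interior_open)
      then consider "cmod \<zeta> = R" | "cmod \<zeta> = R * r" using clG by (force simp: G_def)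
      then show ?thesis
      proof cases
        case 1
        then show ?thesis using R z slice_in_polydisc[of e \<zeta>] e
          by (auto simp: q_def zero_ereal_def[symmetric] intro!: u_nonpos)
      next
        case 2
        have "norm (\<zeta> *s e) < r" using 2 e R r by (simp add: norm_vector_scalar_mult)
        moreover have "q \<zeta> = l * ln r" using 2 R r by (simp add: q_def ln_mult)
        ultimately show ?thesis using bound by simp
      qed
    qed
    show "of_real (norm y) \<in> G" using R by (simp add: G_def)
  qed (auto intro: continuous_intros holomorphic_intros)
  moreover have "of_real (norm y) *s e = y" using ny by (simp add: e_def vec_eq_iff)
  moreover have "ln r' = ln (norm y) - ln R" using ny r by (simp add: R_def ln_div)
  ultimately show ?thesis by (simp add: q_def)
qed

text \<open>By \<open>log_bound_extends\<close> the quotient \<open>A r\<close> is nondecreasing on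
  the interval from 0 to 1. Hence the \<open>Lim\<close> in \<open>lelong0\<close> is a genuine
  limit, equal to the infimum of \<open>A\<close>, and a lower bound for it is a lower bound for
  every \<open>A r\<close>.\<close>

lemma lelong0_slice:
  assumes z: "z \<in> polydisc"
  shows lelong0_ge_iff: "0 \<le> l \<Longrightarrow> ereal l \<le> lelong0 (\<lambda>y. u (z, y)) \<longleftrightarrow>
      (\<forall>r y. 0 < r \<longrightarrow> r < 1 \<longrightarrow> norm y < r \<longrightarrow> u (z, y) \<le> ereal (l * ln r))"
    and lelong0_nonneg: "0 \<le> lelong0 (\<lambda>y. u (z, y))"
proof -
  define A where "A r = (SUP y\<in>ball 0 r. u (z, y)) / ereal (ln r)" for r
  have unp: "u (z, y) \<le> 0" if "norm y < 1" for y
    using z that ball_subset_polydisc by (intro u_nonpos) auto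
  have A_iff: "ereal l \<le> A r \<longleftrightarrow> (\<forall>y. norm y < r \<longrightarrow> u (z, y) \<le> ereal (l * ln r))" if "0 < r" "r < 1" for l r
  proof -
    have "(SUP y\<in>ball 0 r. u (z, y)) \<le> 0" using that by (intro SUP_least unp) auto
    then have "ereal l \<le> A r \<longleftrightarrow> (SUP y\<in>ball 0 r. u (z, y)) \<le> ereal (l * ln r)"
      unfolding A_def using that by (intro ereal_le_divide_neg_iff) auto
    then show ?thesis by (auto simp: SUP_le_iff)
  qed
  have A0: "0 \<le> A r" if "0 < r" "r < 1" for r
    using A_iff[OF that, of 0] unp that by (simp add: zero_ereal_def[symmetric])
  have A_mono: "A r \<le> A r'" if "0 < r" "r < r'" "r' < 1" for r r'
  proof (rule ereal_leI_nonneg_real)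
    show "0 \<le> A r'" using that by (intro A0) auto
    fix l assume l: "0 \<le> l" "ereal l \<le> A r"
    have "\<forall>y. norm y < r \<longrightarrow> u (z, y) \<le> ereal (l * ln r)" using A_iff[of r l] l that by auto
    then show "ereal l \<le> A r'"
      using A_iff[of r' l] log_bound_extends[OF z that l(1)] that by auto
  qed
  define I where "I = (INF r\<in>{0<..<1}. A r)"
  have "(A \<longlongrightarrow> I) (at_right 0)"
  proof (rule order_tendstoI)
    fix a assume "a < I"
    then have "a < A r" if "r \<in> {0<..<1}" for r
      using that unfolding I_def by (meson INF_lower less_le_trans)
    then show "eventually (\<lambda>r. a < A r) (at_right 0)"
      using eventually_at_right_real[of 0 1] by (auto elim: eventually_mono)
  next
    fix a assume "I < a"
    then obtain r' where r': "0 < r'" "r' < 1" "A r' < a" by (auto simp: I_def INF_less_iff)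
    have "A r < a" if "r \<in> {0<..<r'}" for r
      using A_mono[of r r'] r' that by auto
    then show "eventually (\<lambda>r. A r < a) (at_right 0)"
      using eventually_at_right_real[OF r'(1)] by (auto elim: eventually_mono)
  qed
  then have L: "lelong0 (\<lambda>y. u (z, y)) = I"
    unfolding lelong0_def A_def[symmetric] by (intro tendsto_Lim) auto
  show "ereal l \<le> lelong0 (\<lambda>y. u (z, y)) \<longleftrightarrow>
      (\<forall>r y. 0 < r \<longrightarrow> r < 1 \<longrightarrow> norm y < r \<longrightarrow> u (z, y) \<le> ereal (l * ln r))"
    unfolding L I_def le_INF_iff using A_iff by auto
  show "0 \<le> lelong0 (\<lambda>y. u (z, y))"
    unfolding L I_def le_INF_iff using A0 by auto
qed

text \<open>
  The curve \<open>\<zeta> \<mapsto> (a + \<zeta> c, r\<^bsup>h \<zeta>\<^esup> y / r)\<close> passes through \<open>(a, y)\<close>, and \<open>Re h\<close> is a Poisson kernel with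
  pole just outside the unit disc, close to 1: away from 1 it is at most \<open>\<delta>\<close> on the unit circle, and near 1
  the assumed Lelong numbers control \<open>u\<close>.
\<close>
lemma lelong0_propagates:
  assumes disc: "\<And>\<zeta>. cmod \<zeta> \<le> 1 \<Longrightarrow> a + \<zeta> *s c \<in> polydisc"
    and l: "0 \<le> l" "l < l2" and r0: "r0 > 0"
    and near: "\<And>w. w \<in> ball (a + c) r0 \<inter> polydisc \<Longrightarrow> ereal l2 \<le> lelong0 (\<lambda>y. u (w, y))"
  shows "ereal l \<le> lelong0 (\<lambda>y. u (a, y))"
proof -
  have a: "a \<in> polydisc" using disc[of 0] by simp
  have main: "u (a, y) \<le> ereal (l * ln r)" if r: "0 < r" "r < 1" and y: "norm y < r" for r y
  proof -
    define e where "e = of_real (1 / r) *s y"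
    have e: "norm e < 1" using r y by (simp add: e_def norm_vector_scalar_mult norm_divide)
    interpret affine_submean "{\<zeta>. a + \<zeta> *s c \<in> polydisc}" "\<lambda>x. u (a + fst x *s c, snd x *s e)"
      using e by (intro affine_submean_slice) simp
    define T where "T = - ln r"
    have T: "T > 0" using r by (simp add: T_def)
    \<comment> \<open>Chosen so that \<open>l2 * (1 - \<delta>) = l\<close>: the drop from
      \<open>l2\<close> to \<open>l\<close> pays for the part of the circle where only
      \<open>u \<le> 0\<close> is known.\<close>
    define \<delta> where "\<delta> = 1 - l / l2"
    have \<delta>: "\<delta> > 0" using l by (simp add: \<delta>_def)
    \<comment> \<open>For \<open>cmod (\<zeta> - 1) < s\<close> the point
      \<open>a + \<zeta> *s c\<close> is within \<open>r0\<close> of \<open>a + c\<close>, where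
      \<open>near\<close> applies.\<close>
    define s where "s = r0 / (norm c + 1)"
    have c1: "norm c + 1 > 0" by (simp add: add_nonneg_pos)
    have s: "s > 0" "s * norm c < r0"
      using r0 c1 by (auto simp: s_def pos_divide_less_eq)
    \<comment> \<open>On the unit circle the numerator of \<open>Re (h \<zeta>)\<close> is
      \<open>R\<^sup>2 - 1 = \<delta> * s\<^sup>2\<close>, so a distance of at least
      \<open>s\<close> from the pole \<open>R\<close> forces
      \<open>Re (h \<zeta>) \<le> \<delta>\<close>.\<close>
    define R where "R = sqrt (1 + \<delta> * s\<^sup>2)"
    have R: "R > 1" "R\<^sup>2 = 1 + \<delta> * s\<^sup>2" using \<delta> s by (auto simp: R_def)
    define h where "h \<zeta> = (of_real R + \<zeta>) / (of_real R - \<zeta>)" for \<zeta> :: complex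
    have ne: "of_real R - \<zeta> \<noteq> 0" if "cmod \<zeta> \<le> 1" for \<zeta> using that R(1) by auto
    have Reh: "Re (h \<zeta>) = (R\<^sup>2 - (cmod \<zeta>)\<^sup>2) / (cmod (of_real R - \<zeta>))\<^sup>2" for \<zeta>
      unfolding cmod_power2 by (simp add: h_def Re_divide power2_eq_square algebra_simps)
    have Reh_pos: "Re (h \<zeta>) > 0" if "cmod \<zeta> \<le> 1" for \<zeta>
    proof -
      have "(cmod \<zeta>)\<^sup>2 < R\<^sup>2" using that R(1) by (intro power_strict_mono) auto
      then show ?thesis unfolding Reh using ne[OF that] by simp
    qed
    have far: "Re (h \<zeta>) \<le> \<delta>" if "cmod \<zeta> = 1" "cmod (\<zeta> - 1) \<ge> s" for \<zeta>
    proof -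
      \<comment> \<open>On the unit circle the pole \<open>R\<close> is at least as far away as
        1.\<close>
      have "(cmod (of_real R - \<zeta>))\<^sup>2 - (cmod (\<zeta> - 1))\<^sup>2 = (R - 1) * (R + 1 - 2 * Re \<zeta>)"
        unfolding cmod_power2 by (simp add: power2_eq_square algebra_simps)
      moreover have "(R - 1) * (R + 1 - 2 * Re \<zeta>) \<ge> 0"
        using R(1) complex_Re_le_cmod[of \<zeta>] that(1) by (intro mult_nonneg_nonneg) auto
      moreover have "s\<^sup>2 \<le> (cmod (\<zeta> - 1))\<^sup>2" using that(2) s by (intro power_mono) auto
      ultimately have "s\<^sup>2 \<le> (cmod (of_real R - \<zeta>))\<^sup>2" by linarith
      then have "\<delta> * s\<^sup>2 \<le> \<delta> * (cmod (of_real R - \<zeta>))\<^sup>2" using \<delta> by simp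
      then show ?thesis unfolding Reh using ne[of \<zeta>] that(1) R(2) by (simp add: divide_le_eq)
    qed
    define g where "g \<zeta> = exp (- of_real T * h \<zeta>)" for \<zeta>
    have cg: "cmod (g \<zeta>) = exp (- T * Re (h \<zeta>))" for \<zeta> by (simp add: g_def)
    have hol: "h holomorphic_on cball 0 1"
      unfolding h_def using ne by (intro holomorphic_intros) auto
    \<comment> \<open>Near 1, \<open>l2 * ln (cmod (g \<zeta>)) = - l2 * T * Re (h \<zeta>)\<close>
      lies below \<open>Re (Q \<zeta>)\<close>; on the rest of the circle
      \<open>Re (h \<zeta>) \<le> \<delta>\<close> makes \<open>Re (Q \<zeta>)\<close> nonnegative.
      At 0 its value is \<open>l * ln r\<close>.\<close>
    define Q where "Q \<zeta> = - of_real (l2 * T) * (h \<zeta> - of_real \<delta>)" for \<zeta>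
    have holQ: "Q holomorphic_on cball 0 1" unfolding Q_def by (intro holomorphic_intros hol)
    have ReQ: "Re (Q \<zeta>) = - l2 * T * (Re (h \<zeta>) - \<delta>)" for \<zeta> by (simp add: Q_def)
    have holg: "g holomorphic_on cball 0 1" unfolding g_def by (intro holomorphic_intros hol)
    have "u (a + fst (0, g 0) *s c, snd (0 :: complex, g 0) *s e) \<le> ereal (Re (Q 0))"
    proof (rule graph_maximum_principle[where G = "ball 0 1"])
      show "closure (ball 0 1) \<subseteq> {\<zeta>. a + \<zeta> *s c \<in> polydisc}" using disc by auto
      show "g holomorphic_on ball 0 1" by (rule holomorphic_on_subset[OF holg]) auto
      show "continuous_on (closure (ball 0 1)) g"
        using holomorphic_on_imp_continuous_on[OF holg] by simp
      show "cmod (g \<zeta>) < 1" if "\<zeta> \<in> closure (ball 0 1)" for \<zeta>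
        using that Reh_pos[of \<zeta>] T by (simp add: cg)
      show "continuous_on (closure (ball 0 1)) (\<lambda>\<zeta>. Re (Q \<zeta>))"
        using holomorphic_on_imp_continuous_on[OF holQ] by (intro continuous_intros) simp
      show "\<exists>\<rho>>0. \<exists>Q'. Q' holomorphic_on ball \<zeta> \<rho> \<and> (\<forall>\<xi>\<in>ball \<zeta> \<rho>. Re (Q \<xi>) = Re (Q' \<xi>))"
        if \<zeta>: "\<zeta> \<in> ball 0 1" for \<zeta>
      proof -
        obtain \<rho> where "\<rho> > 0" "ball \<zeta> \<rho> \<subseteq> ball 0 1" using \<zeta> by (meson open_ball open_contains_ball)
        then show ?thesis using holomorphic_on_subset[OF holQ, of "ball \<zeta> \<rho>"] ball_subset_cball by blast
      qed
      show "u (a + fst (\<zeta>, g \<zeta>) *s c, snd (\<zeta>, g \<zeta>) *s e) \<le> ereal (Re (Q \<zeta>))" if "\<zeta> \<in> frontier (ball 0 1)" for \<zeta>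
      proof -
        have \<zeta>: "cmod \<zeta> = 1" using that by simp
        have wp: "a + \<zeta> *s c \<in> polydisc" using disc \<zeta> by simp
        have g1: "cmod (g \<zeta>) < 1" using \<zeta> Reh_pos[of \<zeta>] T by (simp add: cg)
        show ?thesis
        proof (cases "cmod (\<zeta> - 1) < s")
          case True
          have "dist (a + c) (a + \<zeta> *s c) = norm ((\<zeta> - 1) *s c)"
            by (simp add: dist_norm norm_minus_commute vector_sub_rdistrib)
          also have "\<dots> \<le> s * norm c"
            unfolding norm_vector_scalar_mult using True by (intro mult_right_mono) auto
          finally have "a + \<zeta> *s c \<in> ball (a + c) r0 \<inter> polydisc" using s wp by simp
          from near[OF this] have N: "\<And>\<rho> y. 0 < \<rho> \<Longrightarrow> \<rho> < 1 \<Longrightarrow> norm y < \<rho> \<Longrightarrow>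
              u (a + \<zeta> *s c, y) \<le> ereal (l2 * ln \<rho>)"
            using lelong0_ge_iff[OF wp, of l2] l by auto
          have "norm (g \<zeta> *s e) < cmod (g \<zeta>) * 1"
            unfolding norm_vector_scalar_mult using e
            by (intro mult_strict_left_mono) (auto simp: g_def)
          then have "u (a + \<zeta> *s c, g \<zeta> *s e) \<le> ereal (l2 * ln (cmod (g \<zeta>)))"
            using g1 by (intro N) (auto simp: g_def)
          also have "l2 * ln (cmod (g \<zeta>)) = - l2 * T * Re (h \<zeta>)" by (simp add: cg)
          also have "ereal \<dots> \<le> ereal (Re (Q \<zeta>))"
            using l T \<delta> by (simp add: ReQ algebra_simps)
          finally show ?thesis by simp
        next
          case False
          have "u (a + \<zeta> *s c, g \<zeta> *s e) \<le> 0"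
            using wp slice_in_polydisc[OF _ g1] e by (intro u_nonpos) auto
          also have "0 \<le> l2 * T * (\<delta> - Re (h \<zeta>))"
            using far[OF \<zeta>] False l T by (intro mult_nonneg_nonneg) auto
          then have "0 \<le> ereal (Re (Q \<zeta>))" by (simp add: ReQ algebra_simps)
          finally show ?thesis by simp
        qed
      qed
    qed auto
    moreover have "h 0 = 1" using R(1) by (simp add: h_def)
    moreover have "g 0 = of_real r"
      using \<open>h 0 = 1\<close> r by (simp add: g_def T_def exp_of_real)
    moreover have "of_real r *s e = y" using r by (simp add: e_def vec_eq_iff)
    moreover have "- l2 * T * (1 - \<delta>) = l * ln r" using l by (simp add: T_def \<delta>_def)
    ultimately show ?thesis by (simp add: ReQ)
  qed
  then show ?thesis using lelong0_ge_iff[OF a l(1)] by blast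
qed

section \<open>Local constancy of \<open>phi\<close>\<close>

text \<open>If the inequality failed, the regularization would provide a ball around
  \<open>b\<close> on which all Lelong numbers exceed that at \<open>a\<close> by a fixed margin,
  and \<open>lelong0_propagates\<close> would carry this to \<open>a\<close>.\<close>

lemma uminus_lelong0_le_phi:
  assumes disc: "\<And>\<zeta>. cmod \<zeta> \<le> 1 \<Longrightarrow> a + \<zeta> *s (b - a) \<in> polydisc"
  shows "- lelong0 (\<lambda>y. u (a, y)) \<le> phi u b"
proof (rule ccontr)
  assume "\<not> ?thesis"
  then have "lelong0 (\<lambda>y. u (a, y)) < - phi u b"
    by (simp add: not_le ereal_less_uminus_reorder)
  then obtain l where l: "lelong0 (\<lambda>y. u (a, y)) < ereal l" "ereal l < - phi u b"
    using ereal_dense2 by blast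
  \<comment> \<open>A second level is inserted because propagation from \<open>b\<close> to
    \<open>a\<close> loses an arbitrarily small amount.\<close>
  then obtain l2 where l2: "ereal l < ereal l2" "ereal l2 < - phi u b"
    using ereal_dense2 by blast
  have "a \<in> polydisc" using disc[of 0] by simp
  then have "0 \<le> ereal l" using lelong0_nonneg l(1) by (meson less_imp_le order_trans)
  have "phi u b < - ereal l2" using l2(2) ereal_less_uminus_reorder by blast
  then obtain r0 where r0: "r0 > 0"
      "(SUP w\<in>ball b r0 \<inter> polydisc. - lelong0 (\<lambda>y. u (w, y))) < - ereal l2"
    unfolding phi_def usc_reg_def INF_less_iff by auto
  have "ereal l \<le> lelong0 (\<lambda>y. u (a, y))"
  proof (rule lelong0_propagates[OF disc])
    fix w assume "w \<in> ball (a + (b - a)) r0 \<inter> polydisc"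
    then have "- lelong0 (\<lambda>y. u (w, y)) \<le> (SUP w\<in>ball b r0 \<inter> polydisc. - lelong0 (\<lambda>y. u (w, y)))"
      by (intro SUP_upper) simp
    then have "- lelong0 (\<lambda>y. u (w, y)) \<le> - ereal l2" using r0(2) by simp
    then show "ereal l2 \<le> lelong0 (\<lambda>y. u (w, y))" by (simp only: ereal_minus_le_minus)
  qed (use l2 r0 \<open>0 \<le> ereal l\<close> in auto)
  then show False using l(1) by simp
qed

lemma phi_locally_constant:
  assumes "x \<in> polydisc"
  obtains d where "d > 0" "ball x d \<subseteq> polydisc" "\<And>a. a \<in> ball x d \<Longrightarrow> phi u a = phi u x"
proof -
  obtain \<epsilon> where \<epsilon>: "\<epsilon> > 0" "ball x \<epsilon> \<subseteq> polydisc" using open_polydisc assms openE by blast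
  \<comment> \<open>The disc centred at \<open>a\<close> with radius
    \<open>norm (b - a) < 2 * d\<close> stays within \<open>3 * d < \<epsilon>\<close> of
    \<open>x\<close>.\<close>
  define d where "d = \<epsilon> / 4"
  have d: "d > 0" using \<epsilon> by (simp add: d_def)
  have le: "- lelong0 (\<lambda>y. u (a, y)) \<le> phi u b" if ab: "a \<in> ball x d" "b \<in> ball x d" for a b
  proof (rule uminus_lelong0_le_phi)
    fix \<zeta> :: complex assume \<zeta>: "cmod \<zeta> \<le> 1"
    have "norm (\<zeta> *s (b - a)) \<le> 1 * norm (b - a)"
      unfolding norm_vector_scalar_mult using \<zeta> by (intro mult_right_mono) auto
    moreover have "norm (b - a) < 2 * d"
      using ab dist_triangle_less_add[of b x d a d] by (simp add: dist_norm norm_minus_commute)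
    moreover have "dist x (a + t) \<le> dist x a + norm t" for t
      using dist_triangle[of x "a + t" a] by (simp add: dist_norm)
    from this[of "\<zeta> *s (b - a)"]
    have "dist x (a + \<zeta> *s (b - a)) \<le> dist x a + norm (\<zeta> *s (b - a))" .
    ultimately have "a + \<zeta> *s (b - a) \<in> ball x \<epsilon>" using ab \<epsilon> by (simp add: d_def)
    then show "a + \<zeta> *s (b - a) \<in> polydisc" using \<epsilon> by auto
  qed
  \<comment> \<open>The pointwise bound \<open>le\<close> holds for all points near
    \<open>a\<close>, so it survives regularization there; the roles of \<open>a\<close> and
    \<open>b\<close> are symmetric, which yields equality.\<close>
  have "phi u a \<le> phi u b" if ab: "a \<in> ball x d" "b \<in> ball x d" for a b
  proof -
    obtain \<rho> where \<rho>: "\<rho> > 0" "ball a \<rho> \<subseteq> ball x d" using ab(1) openE[OF open_ball] by metis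
    have "phi u a \<le> (SUP w\<in>ball a \<rho> \<inter> polydisc. - lelong0 (\<lambda>y. u (w, y)))"
      unfolding phi_def usc_reg_def using \<rho>(1) by (intro INF_lower) auto
    also have "\<dots> \<le> phi u b" using le \<rho>(2) ab(2) by (intro SUP_least) auto
    finally show ?thesis .
  qed
  then have "phi u a = phi u x" if "a \<in> ball x d" for a
    using that d by (intro antisym) auto
  moreover have "ball x d \<subseteq> polydisc" using \<epsilon> by (intro order_trans[OF _ \<epsilon>(2)]) (auto simp: d_def)
  ultimately show thesis using that d by blast
qed

end

theorem theorem4p2:
  fixes u :: "(complex ^ 'k) \<times> (complex ^ 'm) \<Rightarrow> ereal"
  assumes "psh_on (polydisc \<times> polydisc) u"
    and "\<forall>z\<in>polydisc \<times> polydisc. u z \<le> 0"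
  shows "\<exists>c. \<forall>z'\<in>(polydisc :: (complex ^ 'k) set). phi u z' = c"
proof -
  interpret nonpos_psh u using assms by unfold_locales auto
  have "phi u constant_on polydisc"
  proof (rule locally_constant_imp_constant)
    show "connected (polydisc :: (complex ^ 'k) set)" by (intro convex_connected convex_polydisc)
    fix a :: "complex ^ 'k" assume a: "a \<in> polydisc"
    obtain d where d: "d > 0" "ball a d \<subseteq> polydisc" "\<And>x. x \<in> ball a d \<Longrightarrow> phi u x = phi u a"
      using phi_locally_constant[OF a] by blast
    show "\<exists>T. openin (top_of_set polydisc) T \<and> a \<in> T \<and> (\<forall>x\<in>T. phi u x = phi u a)"
    proof (intro exI conjI ballI)
      show "openin (top_of_set polydisc) (ball a d)" using d(2) by (simp add: open_subset)
      show "a \<in> ball a d" using d(1) by simp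
    qed (fact d(3))
  qed
  then show ?thesis by (simp add: constant_on_def)
qed

end
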